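(* Let $X,Y$ be topological spaces and let $f:X\to Y$ be a homotopy equivalence with homotopy inverse $g:Y\to X$. Then $\mathrm{cat}(f)=\mathrm{cat}(g)=\mathrm{cat}(X)=\mathrm{cat}(Y)$.
   Context: A continuous map is null-homotopic if it is (freely) homotopic to a constant map. The category $\mathrm{cat}(f)$ of a continuous map $f:X\to Y$ is the least positive integer $n$ such that $X$ is a union of open subsets $U_1,\dots,U_n$ with each restriction $f_{|U_i}:U_i\to Y$ null-homotopic, and $\infty$ if no such integer exists. The LS category $\mathrm{cat}(X)$ of a space $X$ is the least positive integer $k$ such that $X$ is a union of open subsets $U_1,\dots,U_k$ with each inclusion $U_j\hookrightarrow X$ null-homotopic, and $\infty$ if no such integer exists. *)

theory Defs
  imports "HOL-Analysis.Analysis"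
begin

text \<open>As in \<^const>\<open>contractible_space\<close>, the constant \<open>a\<close> is not required to lie in \<open>Y\<close>. Continuity
  of the constant map forces this when \<open>X\<close> is nonempty; the convention only matters when \<open>X\<close> and
  \<open>Y\<close> are both empty, where the empty map counts as constant. Continuity of \<open>f\<close> is implied, and
  the values of \<open>f\<close> outside \<open>topspace X\<close> are irrelevant.\<close>

definition null_homotopic :: "'a topology \<Rightarrow> 'b topology \<Rightarrow> ('a \<Rightarrow> 'b) \<Rightarrow> bool" where
  "null_homotopic X Y f \<longleftrightarrow> (\<exists>a. homotopic_with (\<lambda>h. True) X Y f (\<lambda>x. a))"

text \<open>Both infima are minima, since \<^typ>\<open>enat\<close> is well-ordered; the infimum of the empty set
  is \<open>\<infinity>\<close>.\<close>

definition map_cat :: "'a topology \<Rightarrow> 'b topology \<Rightarrow> ('a \<Rightarrow> 'b) \<Rightarrow> enat" where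
  "map_cat X Y f = Inf (enat ` {n. n \<ge> 1 \<and>
     (\<exists>U :: nat \<Rightarrow> 'a set. (\<forall>i\<in>{1..n}. openin X (U i)) \<and>
        (\<Union>i\<in>{1..n}. U i) = topspace X \<and>
        (\<forall>i\<in>{1..n}. null_homotopic (subtopology X (U i)) Y f))})"

definition LS_cat :: "'a topology \<Rightarrow> enat" where
  "LS_cat X = Inf (enat ` {k. k \<ge> 1 \<and>
     (\<exists>U :: nat \<Rightarrow> 'a set. (\<forall>j\<in>{1..k}. openin X (U j)) \<and>
        (\<Union>j\<in>{1..k}. U j) = topspace X \<and>
        (\<forall>j\<in>{1..k}. null_homotopic (subtopology X (U j)) X (\<lambda>x. x)))})"

end

(*
  The category of a map does not increase under composition on either side and depends only on the
  homotopy class of the map, and cat(X) is the category of the identity of X. So cat(f) and cat(g)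
  are both at most cat(X) and cat(Y), while cat(X) = cat(g o f) and cat(Y) = cat(f o g) are
  both at most cat(f) and cat(g).
*)
theory Submission
  imports Defs
begin

lemma null_homotopic_compose_left:
  assumes "null_homotopic X Y f" "continuous_map Y Z h"
  shows "null_homotopic X Z (h \<circ> f)"
proof -
  obtain a where "homotopic_with (\<lambda>h. True) X Y f (\<lambda>x. a)"
    using assms(1) by (auto simp: null_homotopic_def)
  then have "homotopic_with (\<lambda>h. True) X Z (h \<circ> f) (h \<circ> (\<lambda>x. a))"
    using assms(2) by (rule homotopic_with_compose_continuous_map_left) simp
  then show ?thesis
    by (auto simp: null_homotopic_def o_def)
qed

lemma null_homotopic_compose_right:
  assumes "null_homotopic Y Z h" "continuous_map X Y f"
  shows "null_homotopic X Z (h \<circ> f)"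
proof -
  obtain a where "homotopic_with (\<lambda>h. True) Y Z h (\<lambda>x. a)"
    using assms(1) by (auto simp: null_homotopic_def)
  then have "homotopic_with (\<lambda>h. True) X Z (h \<circ> f) ((\<lambda>x. a) \<circ> f)"
    using assms(2) by (rule homotopic_with_compose_continuous_map_right) simp
  then show ?thesis
    by (auto simp: null_homotopic_def o_def)
qed

lemma null_homotopic_homotopic:
  assumes "null_homotopic X Y f" "homotopic_with (\<lambda>h. True) X Y f f'"
  shows "null_homotopic X Y f'"
  using assms unfolding null_homotopic_def
  by (meson homotopic_with_symD homotopic_with_trans)

text \<open>An open cover of \<open>Y\<close> admissible for \<open>k\<close> pulls back along
  \<open>p\<close> to an open cover of \<open>X\<close> with equally many members, and
  \<open>null\<close> makes it admissible for \<open>h\<close>. The comparisons of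
  \<open>map_cat\<close> below are instances, with \<open>p\<close> the identity or the map
  precomposed.\<close>

lemma map_cat_le_pullback:
  assumes p: "continuous_map X Y p"
    and null: "\<And>U. \<lbrakk>openin Y U; null_homotopic (subtopology Y U) W k\<rbrakk>
      \<Longrightarrow> null_homotopic (subtopology X {x \<in> topspace X. p x \<in> U}) Z h"
  shows "map_cat X Z h \<le> map_cat Y W k"
  unfolding map_cat_def
\<comment> \<open>\<open>Inf\<close> is antitone, so it suffices that every \<open>n\<close>
  admissible for \<open>k\<close> is admissible for \<open>h\<close>. This also covers the value
  \<infinity>, where no \<open>n\<close> is admissible for \<open>k\<close>.\<close>
proof (intro Inf_superset_mono image_mono Collect_mono impI, elim conjE exE)
  fix n :: nat and U :: "nat \<Rightarrow> 'b set"
  assume n: "1 \<le> n" and op: "\<forall>i\<in>{1..n}. openin Y (U i)"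
    and cov: "(\<Union>i\<in>{1..n}. U i) = topspace Y"
    and nul: "\<forall>i\<in>{1..n}. null_homotopic (subtopology Y (U i)) W k"
  define V where "V i = {x \<in> topspace X. p x \<in> U i}" for i
  have "\<forall>i\<in>{1..n}. openin X (V i)"
    using op p by (simp add: V_def openin_continuous_map_preimage)
  moreover have "(\<Union>i\<in>{1..n}. V i) = topspace X"
    using cov continuous_map_image_subset_topspace[OF p] unfolding V_def by blast
  moreover have "\<forall>i\<in>{1..n}. null_homotopic (subtopology X (V i)) Z h"
    using op nul null by (simp add: V_def)
  ultimately show "1 \<le> n \<and> (\<exists>V. (\<forall>i\<in>{1..n}. openin X (V i)) \<and>
      (\<Union>i\<in>{1..n}. V i) = topspace X \<and>
      (\<forall>i\<in>{1..n}. null_homotopic (subtopology X (V i)) Z h))"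
    using n by blast
qed

text \<open>The same cover serves both maps: following a null-homotopy of \<open>f\<close> on
  \<open>U\<close> by \<open>h\<close> gives one of \<open>h \<circ> f\<close>.\<close>

lemma map_cat_compose_le_right:
  assumes "continuous_map Y Z h"
  shows "map_cat X Z (h \<circ> f) \<le> map_cat X Y f"
proof (rule map_cat_le_pullback[where p = "\<lambda>x. x"])
  fix U assume "openin X U" and null: "null_homotopic (subtopology X U) Y f"
  \<comment> \<open>The left side is the preimage of \<open>U\<close> under the identity, the form
    in which the pullback lemma states its goal.\<close>
  then have "{x \<in> topspace X. x \<in> U} = U"
    using openin_subset by blast
  then show "null_homotopic (subtopology X {x \<in> topspace X. x \<in> U}) Z (h \<circ> f)"
    using null_homotopic_compose_left[OF null assms] by simp
qed simp

text \<open>Here the cover is pulled back along \<open>f\<close> itself: \<open>f\<close> maps the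
  preimage of \<open>U\<close> into \<open>U\<close>, where \<open>h\<close> is
  null-homotopic.\<close>

lemma map_cat_compose_le_left:
  assumes f: "continuous_map X Y f"
  shows "map_cat X Z (h \<circ> f) \<le> map_cat Y Z h"
proof (rule map_cat_le_pullback[OF f])
  fix U assume null: "null_homotopic (subtopology Y U) Z h"
  have "continuous_map (subtopology X {x \<in> topspace X. f x \<in> U}) (subtopology Y U) f"
    using f by (auto simp: continuous_map_in_subtopology continuous_map_from_subtopology)
  then show "null_homotopic (subtopology X {x \<in> topspace X. f x \<in> U}) Z (h \<circ> f)"
    by (rule null_homotopic_compose_right[OF null])
qed

lemma map_cat_homotopic_le:
  assumes "homotopic_with (\<lambda>h. True) X Y f f'"
  shows "map_cat X Y f' \<le> map_cat X Y f"
proof (rule map_cat_le_pullback[where p = "\<lambda>x. x"])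
  fix U assume "openin X U" and null: "null_homotopic (subtopology X U) Y f"
  then have "{x \<in> topspace X. x \<in> U} = U"
    using openin_subset by blast
  \<comment> \<open>Precomposing with \<open>id\<close>, viewed as the inclusion of the subspace,
    restricts the homotopy to \<open>U\<close>.\<close>
  moreover have "homotopic_with (\<lambda>h. True) (subtopology X U) Y f f'"
    using homotopic_with_compose_continuous_map_right[OF assms, of "subtopology X U" id]
    by (simp add: continuous_map_from_subtopology)
  ultimately show "null_homotopic (subtopology X {x \<in> topspace X. x \<in> U}) Y f'"
    using null_homotopic_homotopic[OF null] by simp
qed simp

lemma LS_cat_eq_map_cat_id: "LS_cat X = map_cat X X id"
  by (simp add: LS_cat_def map_cat_def id_def)

text \<open>Write \<open>f\<close> as \<open>f \<circ> id\<close> for the first bound and as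
  \<open>id \<circ> f\<close> for the second.\<close>

lemma map_cat_le_LS_cat:
  assumes "continuous_map X Y f"
  shows "map_cat X Y f \<le> LS_cat X" "map_cat X Y f \<le> LS_cat Y"
  using map_cat_compose_le_right[OF assms, of X id] map_cat_compose_le_left[OF assms, of Y id]
  by (simp_all add: LS_cat_eq_map_cat_id)

text \<open>The identity of \<open>X\<close> factors up to homotopy through \<open>Y\<close>, so its
  category is bounded by that of either factor.\<close>

lemma LS_cat_le_map_cat:
  assumes "continuous_map X Y f" "continuous_map Y X g"
    and "homotopic_with (\<lambda>h. True) X X (g \<circ> f) id"
  shows "LS_cat X \<le> map_cat X Y f" "LS_cat X \<le> map_cat Y X g"
proof -
  have "LS_cat X \<le> map_cat X X (g \<circ> f)"
    unfolding LS_cat_eq_map_cat_id using assms(3) by (rule map_cat_homotopic_le)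
  then show "LS_cat X \<le> map_cat X Y f" "LS_cat X \<le> map_cat Y X g"
    using map_cat_compose_le_right[OF assms(2), of X f] map_cat_compose_le_left[OF assms(1), of X g]
    by (auto intro: order_trans)
qed

theorem mainTheorem15:
  fixes X :: "'a topology" and Y :: "'b topology"
    and f :: "'a \<Rightarrow> 'b" and g :: "'b \<Rightarrow> 'a"
  assumes "continuous_map X Y f"
    and "continuous_map Y X g"
    and "homotopic_with (\<lambda>h. True) X X (g \<circ> f) id"
    and "homotopic_with (\<lambda>h. True) Y Y (f \<circ> g) id"
  shows "map_cat X Y f = map_cat Y X g \<and> map_cat Y X g = LS_cat X \<and> LS_cat X = LS_cat Y"
  \<comment> \<open>The order \<open>assms(2,1,4)\<close> exchanges the roles of \<open>f\<close>
    and \<open>g\<close>, giving the lower bounds for \<open>Y\<close>.\<close>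
  using map_cat_le_LS_cat[OF assms(1)] map_cat_le_LS_cat[OF assms(2)]
    LS_cat_le_map_cat[OF assms(1-3)] LS_cat_le_map_cat[OF assms(2,1,4)]
  by (meson order_antisym order_trans)

end
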